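(* Let $X$ be a second-countable $T_1$-space and assume that the set of points at which $X$ is not semi-locally simply connected is at most countable. If there exists a generalized universal covering space $p\colon\widetilde X\to X$, then the action of the deck transformation group $\Gamma\cong\pi_1(X,x_0)$ on $\widetilde X$ has a Borel-measurable fundamental domain.
   Context: Generalized universal covering space: for a path-connected space $X$ it is a space $\widetilde X$ with a continuous surjection $p\colon\widetilde X\to X$ such that (i) $\widetilde X$ is locally path-connected and simply connected; (ii) if $Y$ is path-connected and locally path-connected, then every pointed continuous map $f\colon(Y,y)\to(X,x)$ with $f_*(\pi_1(Y,y))=1$ admits unique pointed liftings, i.e. for each $\tilde x\in p^{-1}\{x\}$ there is a unique pointed continuous map $g\colon(Y,y)\to(\widetilde X,\tilde x)$ with $p\circ g=f$. The deck transformation group of $p$ is isomorphic to $\pi_1(X,x_0)$ and acts freely and transitively on each fibre. $X$ is semi-locally simply connected at $x$ if there is a neighbourhood $V_x\subset X$ of $x$ with $\mathrm{im}(\pi_1(V_x,x)\to\pi_1(X,x))$ trivial. A fundamental domain is a subset of $\widetilde X$ containing exactly one point of each $\Gamma$-orbit. *)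

theory Defs
  imports "HOL-Analysis.Analysis" "HOL-Algebra.Group_Action"
begin

section \<open>The fundamental group of an abstract topological space\<close>

definition loops_at :: "'a topology \<Rightarrow> 'a \<Rightarrow> (real \<Rightarrow> 'a) set" where
  "loops_at X x = {g. pathin X g \<and> g 0 = x \<and> g 1 = x}"

text \<open>The library's \<open>homotopic_paths\<close> and \<open>joinpaths\<close> are tied to a type-class topology on the
  ambient type; the next two definitions are their counterparts for \<open>'a topology\<close>. Paths
  are total functions on \<open>real\<close>; only their values on \<open>{0..1}\<close> matter.\<close>

definition path_homotopic :: "'a topology \<Rightarrow> (real \<Rightarrow> 'a) \<Rightarrow> (real \<Rightarrow> 'a) \<Rightarrow> bool" where
  "path_homotopic X g h \<longleftrightarrow>
     homotopic_with (\<lambda>r. r 0 = g 0 \<and> r 1 = g 1) (top_of_set {0..1}) X g h"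

definition path_join :: "(real \<Rightarrow> 'a) \<Rightarrow> (real \<Rightarrow> 'a) \<Rightarrow> real \<Rightarrow> 'a" where
  "path_join g h = (\<lambda>t. if t \<le> 1/2 then g (2 * t) else h (2 * t - 1))"

definition loop_class :: "'a topology \<Rightarrow> 'a \<Rightarrow> (real \<Rightarrow> 'a) \<Rightarrow> (real \<Rightarrow> 'a) set" where
  "loop_class X x g = {h \<in> loops_at X x. path_homotopic X g h}"

text \<open>Operations on classes are written as unions over representatives; all members of the
  union coincide, so no choice of representative is involved.\<close>

definition fundamental_group :: "'a topology \<Rightarrow> 'a \<Rightarrow> (real \<Rightarrow> 'a) set monoid" where
  "fundamental_group X x =
     \<lparr>carrier = loop_class X x ` loops_at X x,
      mult = (\<lambda>A B. \<Union>g\<in>A. \<Union>h\<in>B. loop_class X x (path_join g h)),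
      one = loop_class X x (\<lambda>_. x)\<rparr>"

definition induced_hom ::
    "'b topology \<Rightarrow> ('a \<Rightarrow> 'b) \<Rightarrow> 'a \<Rightarrow> (real \<Rightarrow> 'a) set \<Rightarrow> (real \<Rightarrow> 'b) set" where
  "induced_hom X f y A = (\<Union>g\<in>A. loop_class X (f y) (f \<circ> g))"

definition trivial_on_fundamental_group ::
    "'a topology \<Rightarrow> 'b topology \<Rightarrow> ('a \<Rightarrow> 'b) \<Rightarrow> 'a \<Rightarrow> bool" where
  "trivial_on_fundamental_group Y X f y \<longleftrightarrow>
     induced_hom X f y ` carrier (fundamental_group Y y) = {\<one>\<^bsub>fundamental_group X (f y)\<^esub>}"

definition simply_connected_space :: "'a topology \<Rightarrow> bool" where
  "simply_connected_space X \<longleftrightarrow>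
     path_connected_space X \<and>
     (\<forall>x\<in>topspace X. carrier (fundamental_group X x) = {\<one>\<^bsub>fundamental_group X x\<^esub>})"

text \<open>The neighbourhood \<open>V\<close> need not be open, and only loops based at \<open>x\<close> itself are
  considered.\<close>

definition semilocally_simply_connected_at :: "'a topology \<Rightarrow> 'a \<Rightarrow> bool" where
  "semilocally_simply_connected_at X x \<longleftrightarrow>
     (\<exists>U V. openin X U \<and> x \<in> U \<and> U \<subseteq> V \<and> V \<subseteq> topspace X \<and>
        trivial_on_fundamental_group (subtopology X V) X (\<lambda>v. v) x)"

section \<open>Generalized universal covering spaces\<close>

text \<open>Uniqueness is that of functions on \<open>topspace Y\<close>, hence the restriction to extensional
  functions.\<close>

definition has_unique_pointed_liftings ::
    "'b topology \<Rightarrow> 'a topology \<Rightarrow> ('b \<Rightarrow> 'a) \<Rightarrow> 'c topology \<Rightarrow> bool" where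
  "has_unique_pointed_liftings Xt X p Y \<longleftrightarrow>
     (\<forall>f. \<forall>y\<in>topspace Y.
        continuous_map Y X f \<and> trivial_on_fundamental_group Y X f y \<longrightarrow>
        (\<forall>xt\<in>topspace Xt. p xt = f y \<longrightarrow>
           (\<exists>!g. g \<in> extensional (topspace Y) \<and> continuous_map Y Xt g \<and> g y = xt \<and>
                 (\<forall>z\<in>topspace Y. p (g z) = f z))))"

text \<open>
  HOL cannot quantify over all types inside a definition, so the test spaces \<open>Y\<close> range over all
  topologies on (subsets of) one type that is large enough for the lifting property to follow
  for test spaces on every type:

  \<^item> This type contains copies of \<open>{0..1}\<close> and of \<open>{0..1} \<times> {0..1}\<close>, whence paths
    and path homotopies in \<open>X\<close> lift uniquely. So, for arbitrary \<open>Y\<close>, there is at most one lift of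
    \<open>f\<close> through a given point, and lifting \<open>f \<circ> c\<close> for paths \<open>c\<close> in \<open>Y\<close> gives a
    well-defined function \<open>g\<close> over \<open>f\<close>.

  \<^item> Suppose \<open>g\<close> were discontinuous at \<open>z\<close>, with an open \<open>W\<close> around \<open>g z\<close> that contains
    the \<open>g\<close>-image of no neighbourhood of \<open>z\<close>. For each open \<open>U\<close> around \<open>f z\<close>
    choose a path \<open>c\<^sub>U\<close> inside the preimage of \<open>U\<close> under \<open>f\<close>, from \<open>z\<close> to a point that
    \<open>g\<close> maps outside \<open>W\<close>. Let the fan \<open>F\<close> consist of one arc for each \<open>U\<close>, glued at
    their initial points to a hub, where a neighbourhood of the hub contains all arcs with
    \<open>U \<subseteq> U\<^sub>0\<close>, for some \<open>U\<^sub>0\<close>, and an initial segment of every other arc. Then \<open>F\<close> is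
    contractible and locally path-connected, the maps \<open>f \<circ> c\<^sub>U\<close> form a continuous map
    \<open>F \<rightarrow> X\<close>, and \<open>F\<close> embeds in \<open>'a set \<times> real\<close>. So this map has a continuous lift, which
    agrees with \<open>g \<circ> c\<^sub>U\<close> on the arcs, contradicting the choice of their end points.

  The factor \<open>'b\<close> makes the covering space itself directly available as a test space.
\<close>

definition generalized_universal_covering ::
    "'b topology \<Rightarrow> 'a topology \<Rightarrow> ('b \<Rightarrow> 'a) \<Rightarrow> bool" where
  "generalized_universal_covering Xt X p \<longleftrightarrow>
     path_connected_space X \<and>
     continuous_map Xt X p \<and> p ` topspace Xt = topspace X \<and>
     locally_path_connected_space Xt \<and> simply_connected_space Xt \<and>
     (\<forall>Y :: ('a set \<times> 'b \<times> real) topology.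
        path_connected_space Y \<and> locally_path_connected_space Y \<longrightarrow>
        has_unique_pointed_liftings Xt X p Y)"

definition deck_group :: "'b topology \<Rightarrow> ('b \<Rightarrow> 'a) \<Rightarrow> ('b \<Rightarrow> 'b) monoid" where
  "deck_group Xt p =
     BijGroup (topspace Xt)
       \<lparr>carrier := {h \<in> Bij (topspace Xt).
                    homeomorphic_map Xt Xt h \<and> (\<forall>z\<in>topspace Xt. p (h z) = p z)}\<rparr>"

definition fundamental_domain :: "_ \<Rightarrow> 'b set \<Rightarrow> ('g \<Rightarrow> 'b \<Rightarrow> 'b) \<Rightarrow> 'b set \<Rightarrow> bool" where
  "fundamental_domain G E \<phi> F \<longleftrightarrow> F \<subseteq> E \<and> (\<forall>A\<in>orbits G E \<phi>. \<exists>!z. z \<in> F \<inter> A)"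

definition borel_sets_of :: "'a topology \<Rightarrow> 'a set set" where
  "borel_sets_of X = sigma_sets (topspace X) {U. openin X U}"

end

theory Submission
  imports Defs
begin

text \<open>
  The deck group acts simply transitively on each fibre, so its orbits are the fibres of \<open>p\<close> and a
  fundamental domain is a cross-section of \<open>p\<close>. For open \<open>U\<close> in \<open>X\<close>, the deck group permutes the path
  components of the preimage of \<open>U\<close>, which are open. Selecting one from each orbit of those on which
  \<open>p\<close> is injective gives an open set on which \<open>p\<close> is still injective. With \<open>U\<close> ranging over a
  countable base, these open sets meet every fibre over a point at which \<open>X\<close> is semi-locally
  simply connected; making them disjoint modulo the deck group yields a Borel partial cross-section.
  Only countably many fibres are missed, and one point from each of them can be added because
  points of the covering space are closed.
\<close>

section \<open>Loop classes\<close>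

text \<open>The end-point condition in \<open>path_homotopic\<close> mentions its first path
  \<open>g\<close>. Expressed through the base point it is the same for all loops at
  \<open>x\<close>, so symmetry and transitivity of \<open>homotopic_with\<close> become
  applicable.\<close>

lemma path_homotopic_loop_iff:
  assumes "g \<in> loops_at X x"
  shows "path_homotopic X g h \<longleftrightarrow>
    homotopic_with (\<lambda>r. r 0 = x \<and> r 1 = x) (top_of_set {0..1}) X g h"
  using assms by (simp add: path_homotopic_def loops_at_def)

lemma path_homotopic_refl: "g \<in> loops_at X x \<Longrightarrow> path_homotopic X g g"
  by (simp add: path_homotopic_def loops_at_def pathin_def)

lemma loop_class_eq_iff:
  assumes g: "g \<in> loops_at X x" and h: "h \<in> loops_at X x"
  shows "loop_class X x g = loop_class X x h \<longleftrightarrow> path_homotopic X g h"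
proof
  assume "loop_class X x g = loop_class X x h"
  then show "path_homotopic X g h"
    using h path_homotopic_refl[OF h] by (auto simp: loop_class_def)
next
  assume "path_homotopic X g h"
  then have *: "homotopic_with (\<lambda>r. r 0 = x \<and> r 1 = x) (top_of_set {0..1}) X g h"
    by (simp add: path_homotopic_loop_iff[OF g])
  have "path_homotopic X g k \<longleftrightarrow> path_homotopic X h k" for k
    unfolding path_homotopic_loop_iff[OF g] path_homotopic_loop_iff[OF h]
    using * by (meson homotopic_with_symD homotopic_with_trans)
  then show "loop_class X x g = loop_class X x h"
    by (simp add: loop_class_def)
qed

lemma const_in_loops_at: "x \<in> topspace X \<Longrightarrow> (\<lambda>_. x) \<in> loops_at X x"
  by (simp add: loops_at_def)

lemma loops_at_compose:
  "continuous_map Y X f \<Longrightarrow> g \<in> loops_at Y y \<Longrightarrow> f \<circ> g \<in> loops_at X (f y)"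
  by (auto simp: loops_at_def intro: pathin_compose)

lemma path_homotopic_compose:
  assumes f: "continuous_map Y X f" and g: "g \<in> loops_at Y y" and gh: "path_homotopic Y g h"
  shows "path_homotopic X (f \<circ> g) (f \<circ> h)"
  using gh unfolding path_homotopic_loop_iff[OF g] path_homotopic_loop_iff[OF loops_at_compose[OF f g]]
  by (rule homotopic_with_compose_continuous_map_left[OF _ f]) auto

text \<open>The union over representatives collapses, because homotopic loops have homotopic images
  and so contribute the same class.\<close>

lemma induced_hom_loop_class:
  assumes f: "continuous_map Y X f" and g: "g \<in> loops_at Y y"
  shows "induced_hom X f y (loop_class Y y g) = loop_class X (f y) (f \<circ> g)"
proof -
  have "loop_class X (f y) (f \<circ> h) = loop_class X (f y) (f \<circ> g)" if "h \<in> loop_class Y y g" for h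
    using that path_homotopic_compose[OF f g]
    by (metis (no_types, lifting) f g loop_class_def loop_class_eq_iff loops_at_compose mem_Collect_eq)
  moreover have "g \<in> loop_class Y y g"
    using g by (simp add: loop_class_def path_homotopic_refl)
  ultimately show ?thesis
    unfolding induced_hom_def by blast
qed

text \<open>Trades classes for loops, both for feeding the lifting property and for exploiting
  semi-local simple connectedness.\<close>

lemma trivial_on_fundamental_group_iff:
  assumes f: "continuous_map Y X f" and y: "y \<in> topspace Y"
  shows "trivial_on_fundamental_group Y X f y \<longleftrightarrow>
    (\<forall>g\<in>loops_at Y y. path_homotopic X (\<lambda>_. f y) (f \<circ> g))"
proof -
  have fy: "f y \<in> topspace X"
    using f y by (auto simp: continuous_map_def)
  have "trivial_on_fundamental_group Y X f y \<longleftrightarrow>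
      (\<lambda>g. loop_class X (f y) (f \<circ> g)) ` loops_at Y y = {loop_class X (f y) (\<lambda>_. f y)}"
    by (simp add: trivial_on_fundamental_group_def fundamental_group_def image_image
        induced_hom_loop_class[OF f] cong: image_cong_simp)
  also have "\<dots> \<longleftrightarrow> (\<forall>g\<in>loops_at Y y. loop_class X (f y) (\<lambda>_. f y) = loop_class X (f y) (f \<circ> g))"
  proof -
    \<comment> \<open>Equality with a singleton also needs \<open>A\<close> to be nonempty; the
      constant loop provides this.\<close>
    have "F ` A = {a} \<longleftrightarrow> (\<forall>g\<in>A. a = F g)" if "A \<noteq> {}" for F :: "(real \<Rightarrow> 'a) \<Rightarrow> (real \<Rightarrow> 'b) set" and A a
      using that by auto
    then show ?thesis
      using const_in_loops_at[OF y] by blast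
  qed
  also have "\<dots> \<longleftrightarrow> (\<forall>g\<in>loops_at Y y. path_homotopic X (\<lambda>_. f y) (f \<circ> g))"
    by (intro ball_cong refl loop_class_eq_iff const_in_loops_at[OF fy] loops_at_compose[OF f])
  finally show ?thesis .
qed

lemma simply_connected_space_loops_trivial:
  assumes "simply_connected_space Y" and g: "g \<in> loops_at Y y"
  shows "path_homotopic Y (\<lambda>_. y) g"
proof -
  have y: "y \<in> topspace Y"
    using g path_start_in_topspace by (force simp: loops_at_def)
  have "loop_class Y y g = loop_class Y y (\<lambda>_. y)"
    using assms y by (auto simp: simply_connected_space_def fundamental_group_def)
  then show ?thesis
    using loop_class_eq_iff[OF const_in_loops_at[OF y] g] by simp
qed

text \<open>In a simply connected set a loop contracts to the line path from its base point to
  itself, which is the constant loop.\<close>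

lemma convex_loops_trivial:
  fixes S :: "'c::real_normed_vector set"
  assumes "convex S" and g: "g \<in> loops_at (top_of_set S) y"
  shows "path_homotopic (top_of_set S) (\<lambda>_. y) g"
proof -
  have "homotopic_paths S g (linepath (pathstart g) (pathstart g))"
    using convex_imp_simply_connected[OF \<open>convex S\<close>] g
    unfolding simply_connected_eq_contractible_path
    by (auto simp: loops_at_def pathin_canon_iff path_defs)
  moreover have "linepath (pathstart g) (pathstart g) = (\<lambda>_. y)"
    using g by (auto simp: loops_at_def pathstart_def linepath_def algebra_simps
        simp flip: scaleR_add_left)
  ultimately have "homotopic_paths S (\<lambda>_. y) g"
    using homotopic_paths_sym by metis
  then show ?thesis
    by (simp add: homotopic_paths_def path_homotopic_def pathstart_def pathfinish_def)
qed

lemma convex_locally_path_connected_space: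
  fixes S :: "'c::real_normed_vector set"
  assumes "convex S"
  shows "locally_path_connected_space (top_of_set S)"
  using convex_imp_locally_path_connected[OF assms]
  unfolding locally_path_connected locally_path_connected_space path_connectedin_subtopology
    path_connectedin_euclidean
  by (meson openin_imp_subset)

section \<open>Lifting maps and the deck transformation group\<close>

locale generalized_universal_cover =
  fixes Xt :: "'b topology" and X :: "'a topology" and p :: "'b \<Rightarrow> 'a"
  assumes covering: "generalized_universal_covering Xt X p"
begin

lemma p_continuous: "continuous_map Xt X p"
  and p_onto: "p ` topspace Xt = topspace X"
  and locally_path_connected: "locally_path_connected_space Xt"
  and simply_connected: "simply_connected_space Xt"
  and path_connected: "path_connected_space Xt"
  using covering by (auto simp: generalized_universal_covering_def simply_connected_space_def)

text \<open>The covering property speaks only of test spaces on one type. A space on another type is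
  copied there along the injection \<open>e\<close>; lifts are then transported in both
  directions.\<close>

lemma unique_lift:
  fixes Y :: "'c topology" and e :: "'c \<Rightarrow> 'a set \<times> 'b \<times> real"
  assumes e: "inj_on e (topspace Y)"
    and Y: "path_connected_space Y" "locally_path_connected_space Y"
    and y: "y \<in> topspace Y" and f: "continuous_map Y X f"
    and loops: "\<forall>g\<in>loops_at Y y. path_homotopic X (\<lambda>_. f y) (f \<circ> g)"
    and w: "w \<in> topspace Xt" "p w = f y"
  shows "\<exists>g. continuous_map Y Xt g \<and> g y = w \<and> (\<forall>z\<in>topspace Y. p (g z) = f z)"
    and "\<lbrakk>continuous_map Y Xt g; g y = w; \<And>z. z \<in> topspace Y \<Longrightarrow> p (g z) = f z;
          continuous_map Y Xt g'; g' y = w; \<And>z. z \<in> topspace Y \<Longrightarrow> p (g' z) = f z;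
          z \<in> topspace Y\<rbrakk> \<Longrightarrow> g z = g' z"
proof -
  define e' where "e' = inv_into (topspace Y) e"
  \<comment> \<open>\<open>Z\<close> is the image of \<open>e\<close> with the topology induced by
    the inverse \<open>e'\<close>, which makes \<open>e\<close> a homeomorphism from
    \<open>Y\<close> onto \<open>Z\<close>.\<close>
  define Z where "Z = pullback_topology (e ` topspace Y) e' Y"
  have e'e: "e' (e z) = z" if "z \<in> topspace Y" for z
    using e that by (simp add: e'_def)
  have tZ: "topspace Z = e ` topspace Y"
    by (auto simp: Z_def topspace_pullback_topology e'e)
  have ce: "continuous_map Y Z e"
    unfolding Z_def by (rule continuous_map_pullback', rule continuous_map_eq[OF continuous_map_id])
      (auto simp: e'e)
  have ce': "continuous_map Z Y e'"
    unfolding Z_def using continuous_map_pullback[OF continuous_map_id] by (metis id_comp)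
  have "Y homeomorphic_space Z"
    unfolding homeomorphic_space_def homeomorphic_maps_def using ce ce' e'e tZ
    by (intro exI[of _ e] exI[of _ e']) auto
  then have Z: "path_connected_space Z" "locally_path_connected_space Z"
    using Y homeomorphic_path_connected_space homeomorphic_locally_path_connected_space by blast+
  have fe': "continuous_map Z X (f \<circ> e')"
    using ce' f by (rule continuous_map_compose)
  have ey: "e y \<in> topspace Z"
    using y tZ by simp
  have "path_homotopic X (\<lambda>_. f y) ((f \<circ> e') \<circ> g)" if "g \<in> loops_at Z (e y)" for g
    using loops loops_at_compose[OF ce' that] e'e[OF y] by (simp add: comp_assoc)
  then have triv: "trivial_on_fundamental_group Z X (f \<circ> e') (e y)"
    unfolding trivial_on_fundamental_group_iff[OF fe' ey] using e'e[OF y] by simp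
  have lifts: "has_unique_pointed_liftings Xt X p Z"
    using covering Z by (simp add: generalized_universal_covering_def)
  have pw: "p w = (f \<circ> e') (e y)"
    using w e'e[OF y] by simp
  have ex1: "\<exists>!g. g \<in> extensional (topspace Z) \<and> continuous_map Z Xt g \<and> g (e y) = w \<and>
      (\<forall>z\<in>topspace Z. p (g z) = (f \<circ> e') z)"
    using lifts[unfolded has_unique_pointed_liftings_def, rule_format, OF ey conjI[OF fe' triv] w(1) pw] .
  then obtain g where g: "continuous_map Z Xt g" "g (e y) = w"
      "\<forall>z\<in>topspace Z. p (g z) = (f \<circ> e') z" by blast
  have "continuous_map Y Xt (g \<circ> e)"
    using ce g(1) by (rule continuous_map_compose)
  with g show "\<exists>g. continuous_map Y Xt g \<and> g y = w \<and> (\<forall>z\<in>topspace Y. p (g z) = f z)"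
    by (intro exI[of _ "g \<circ> e"]) (auto simp: tZ e'e)
  \<comment> \<open>Uniqueness holds among extensional functions, so the transported lift is cut off
    outside \<open>topspace Z\<close>.\<close>
  let ?r = "\<lambda>h. restrict (h \<circ> e') (topspace Z)"
  have r: "?r h \<in> extensional (topspace Z) \<and> continuous_map Z Xt (?r h) \<and> ?r h (e y) = w \<and>
      (\<forall>z\<in>topspace Z. p (?r h z) = (f \<circ> e') z)"
    if "continuous_map Y Xt h" "h y = w" "\<And>z. z \<in> topspace Y \<Longrightarrow> p (h z) = f z" for h
  proof (intro conjI)
    show "continuous_map Z Xt (?r h)"
      by (rule continuous_map_eq[OF continuous_map_compose[OF ce' that(1)]]) simp
  qed (use that y in \<open>auto simp: tZ e'e\<close>)
  fix g g' z
  assume "continuous_map Y Xt g" "g y = w" "\<And>z. z \<in> topspace Y \<Longrightarrow> p (g z) = f z"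
    "continuous_map Y Xt g'" "g' y = w" "\<And>z. z \<in> topspace Y \<Longrightarrow> p (g' z) = f z"
    and z: "z \<in> topspace Y"
  then have "?r g = ?r g'"
    using r ex1 by blast
  then have "?r g (e z) = ?r g' (e z)"
    by simp
  then show "g z = g' z"
    using z by (simp add: tZ e'e)
qed

text \<open>The test type contains a copy of every subset of the plane, since the plane and the line have
  the same cardinality; hence path homotopies can be lifted.\<close>

lemma convex_plane_unique_lift:
  fixes S :: "(real \<times> real) set"
  assumes S: "convex S"
    and y: "y \<in> S" and f: "continuous_map (top_of_set S) X f"
    and w: "w \<in> topspace Xt" "p w = f y"
  shows "\<exists>g. continuous_map (top_of_set S) Xt g \<and> g y = w \<and> (\<forall>z\<in>S. p (g z) = f z)"
    and "\<lbrakk>continuous_map (top_of_set S) Xt g; g y = w; \<And>z. z \<in> S \<Longrightarrow> p (g z) = f z;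
          continuous_map (top_of_set S) Xt g'; g' y = w; \<And>z. z \<in> S \<Longrightarrow> p (g' z) = f z;
          z \<in> S\<rbrakk> \<Longrightarrow> g z = g' z"
proof -
  obtain b :: "real \<times> real \<Rightarrow> real" where "bij b"
    using card_of_Times_same_infinite[OF infinite_UNIV_char_0[where 'a = real]]
    unfolding card_of_ordIso[symmetric] UNIV_Times_UNIV by blast
  then have e: "inj_on (\<lambda>q. ({}, undefined, b q) :: 'a set \<times> 'b \<times> real) (topspace (top_of_set S))"
    by (intro inj_onI) (simp only: prod.inject bij_is_inj[THEN inj_eq])
  have pc: "path_connected_space (top_of_set S)"
    using S by (simp add: convex_imp_path_connected)
  \<comment> \<open>Loops in a convex set contract, so every continuous map on \<open>S\<close>
    satisfies the hypothesis on loops.\<close>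
  have loops: "\<forall>g\<in>loops_at (top_of_set S) y. path_homotopic X (\<lambda>_. f y) (f \<circ> g)"
    using path_homotopic_compose[OF f const_in_loops_at convex_loops_trivial[OF S]] y
    by (simp add: o_def)
  note lift = unique_lift[OF e pc convex_locally_path_connected_space[OF S] _ f loops w]
  show "\<exists>g. continuous_map (top_of_set S) Xt g \<and> g y = w \<and> (\<forall>z\<in>S. p (g z) = f z)"
    using lift(1) y by simp
  show "\<lbrakk>continuous_map (top_of_set S) Xt g; g y = w; \<And>z. z \<in> S \<Longrightarrow> p (g z) = f z;
          continuous_map (top_of_set S) Xt g'; g' y = w; \<And>z. z \<in> S \<Longrightarrow> p (g' z) = f z;
          z \<in> S\<rbrakk> \<Longrightarrow> g z = g' z"
    using lift(2) y by simp
qed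

section \<open>Lifting paths and null-homotopies\<close>

text \<open>A path is a map on the degenerate rectangle \<open>?S\<close> in the plane, so unique
  lifting from convex plane sets applies.\<close>

lemma path_lift_unique:
  assumes c: "pathin Xt c" and d: "pathin Xt d" and "c 0 = d 0"
    and pcd: "\<And>t. t \<in> {0..1} \<Longrightarrow> p (c t) = p (d t)" and t: "t \<in> {0..1}"
  shows "c t = d t"
proof -
  let ?S = "{0..1::real} \<times> {0::real}"
  have fst: "continuous_map (top_of_set ?S) (top_of_set {0..1}) fst"
    by (auto intro!: continuous_intros)
  have lift: "continuous_map (top_of_set ?S) Xt (c \<circ> fst)" "continuous_map (top_of_set ?S) Xt (d \<circ> fst)"
    using c d unfolding pathin_def by (auto intro: continuous_map_compose[OF fst])
  have c0: "c 0 \<in> topspace Xt"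
    using c by (rule path_start_in_topspace)
  have "(c \<circ> fst) (t, 0::real) = (d \<circ> fst) (t, 0::real)"
    by (rule convex_plane_unique_lift(2)[where S = ?S and y = "(0,0)" and f = "p \<circ> (c \<circ> fst)" and w = "c 0"
          and g = "c \<circ> fst" and g' = "d \<circ> fst" and z = "(t,0)"])
      (use lift continuous_map_compose[OF lift(1) p_continuous] c0 \<open>c 0 = d 0\<close> pcd t
        in \<open>auto intro!: convex_Times\<close>)
  then show ?thesis
    by simp
qed

text \<open>Lift the null-homotopy to the square. Three sides lie over a constant path and hence
  lift to constants. The fourth lies over \<open>p \<circ> c\<close> and starts at
  \<open>c 0\<close>, so it is \<open>c\<close>; its end is a corner where the lift equals
  \<open>c 0\<close>.\<close>

lemma lift_of_null_homotopic_loop_closed: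
  assumes c: "pathin Xt c"
    and null: "path_homotopic X (\<lambda>_. p (c 0)) (p \<circ> c)"
  shows "c 1 = c 0"
proof -
  let ?x = "p (c 0)" and ?w = "c 0" and ?S = "{0..1::real} \<times> {0..1::real}"
  have c0: "?w \<in> topspace Xt"
    using c by (rule path_start_in_topspace)
  obtain H where H: "continuous_map (top_of_set ?S) X H"
    and H0: "\<And>t. H (0, t) = ?x" and H1: "\<And>t. H (1, t) = p (c t)"
    and Hs: "\<And>s. s \<in> {0..1} \<Longrightarrow> H (s, 0) = ?x \<and> H (s, 1) = ?x"
    using null unfolding path_homotopic_def homotopic_with_def
    by (auto simp: prod_topology_subtopology euclidean_product_topology subtopology_subtopology Times_Int_Times)
  obtain G where G: "continuous_map (top_of_set ?S) Xt G" and G00: "G (0,0) = ?w"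
    and pG: "\<And>z. z \<in> ?S \<Longrightarrow> p (G z) = H z"
    using convex_plane_unique_lift(1)[of ?S "(0,0)" H ?w] H H0 c0 by (auto simp: convex_Times)
  \<comment> \<open>The segment starting at \<open>(a, b)\<close> in direction
    \<open>(s, r)\<close>; its instances are the four sides of the square.\<close>
  have edge: "pathin Xt (\<lambda>t. G (a + s * t, b + r * t))"
    if "\<And>t. t \<in> {0..1} \<Longrightarrow> a + s * t \<in> {0..1} \<and> b + r * t \<in> {0..1}" for a b s r
  proof -
    have "continuous_map (top_of_set {0..1}) (top_of_set ?S) (\<lambda>t. (a + s * t, b + r * t))"
    proof -
      have "continuous_on {0..1} (\<lambda>t. (a + s * t, b + r * t))"
        by (intro continuous_intros)
      then show ?thesis
        using that by (auto simp: continuous_map_in_subtopology)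
    qed
    from continuous_map_compose[OF this G] show ?thesis
      by (simp add: pathin_def o_def)
  qed
  have const: "pathin Xt (\<lambda>_. ?w)"
    using c0 by simp
  have "G (0, t) = ?w" if "t \<in> {0..1}" for t
    using path_lift_unique[OF edge[of 0 0 0 1] const, of t] that by (simp add: G00 pG H0)
  then have G01: "G (0, 1) = ?w"
    by simp
  have G10: "G (1, 0) = ?w"
    using path_lift_unique[OF edge[of 0 1 0 0] const, of 1] by (simp add: G00 pG Hs)
  have G11: "G (1, 1) = ?w"
    using path_lift_unique[OF edge[of 0 1 1 0] const, of 1] by (simp add: G01 pG Hs)
  show ?thesis
    using path_lift_unique[OF edge[of 1 0 0 1] c, of 1] by (simp add: G10 G11 pG H1)
qed

section \<open>Deck transformations and fibres\<close>

text \<open>\<open>Xt\<close> serves as its own test space: it is simply connected, so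
  \<open>p\<close> kills all its loops. The second part compares a lift of \<open>p\<close> with the
  identity.\<close>

lemma self_lift:
  assumes z: "z \<in> topspace Xt" and w: "w \<in> topspace Xt" "p w = p z"
  shows "\<exists>g. continuous_map Xt Xt g \<and> g z = w \<and> (\<forall>u\<in>topspace Xt. p (g u) = p u)"
    and "\<lbrakk>continuous_map Xt Xt g; g z = z; \<And>u. u \<in> topspace Xt \<Longrightarrow> p (g u) = p u;
          u \<in> topspace Xt\<rbrakk> \<Longrightarrow> g u = u"
proof -
  have e: "inj_on (\<lambda>u. ({}, u, 0) :: 'a set \<times> 'b \<times> real) (topspace Xt)"
    by (auto simp: inj_on_def)
  have loops: "\<forall>g\<in>loops_at Xt z. path_homotopic X (\<lambda>_. p z) (p \<circ> g)"
    using path_homotopic_compose[OF p_continuous const_in_loops_at[OF z]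
        simply_connected_space_loops_trivial[OF simply_connected]]
    by (simp add: o_def)
  note lift = unique_lift[OF e path_connected locally_path_connected z p_continuous loops]
  show "\<exists>g. continuous_map Xt Xt g \<and> g z = w \<and> (\<forall>u\<in>topspace Xt. p (g u) = p u)"
    using lift(1) w by blast
  show "\<lbrakk>continuous_map Xt Xt g; g z = z; \<And>u. u \<in> topspace Xt \<Longrightarrow> p (g u) = p u;
          u \<in> topspace Xt\<rbrakk> \<Longrightarrow> g u = u"
    using lift(2)[OF z refl, of g id u] by auto
qed

text \<open>Lift \<open>p\<close> once with \<open>z\<close> sent to \<open>w\<close> and once with
  \<open>w\<close> sent to \<open>z\<close>. Both composites cover \<open>p\<close> and fix a point,
  so they are the identity.\<close>

lemma deck_transitive:
  assumes z: "z \<in> topspace Xt" and w: "w \<in> topspace Xt" "p w = p z"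
  obtains h where "h \<in> carrier (deck_group Xt p)" "h z = w"
proof -
  obtain g where g: "continuous_map Xt Xt g" "g z = w" "\<forall>u\<in>topspace Xt. p (g u) = p u"
    using self_lift(1)[OF assms] by blast
  obtain k where k: "continuous_map Xt Xt k" "k w = z" "\<forall>u\<in>topspace Xt. p (k u) = p u"
    using self_lift(1)[OF w(1) z] w by metis
  have gt: "g u \<in> topspace Xt" "k u \<in> topspace Xt" if "u \<in> topspace Xt" for u
    using g(1) k(1) that by (auto simp: continuous_map_def)
  have kg: "k (g u) = u" if "u \<in> topspace Xt" for u
    using self_lift(2)[OF z z refl, of "k \<circ> g" u] g k gt that
    by (auto intro: continuous_map_compose)
  have gk: "g (k u) = u" if "u \<in> topspace Xt" for u
    using self_lift(2)[OF w(1) w(1) refl, of "g \<circ> k" u] g k gt that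
    by (auto intro: continuous_map_compose)
  have hom: "homeomorphic_map Xt Xt g"
    unfolding homeomorphic_map_maps homeomorphic_maps_def using g k kg gk by blast
  \<comment> \<open>Members of \<open>Bij\<close> are extensional, hence the restriction.\<close>
  let ?h = "restrict g (topspace Xt)"
  have homh: "homeomorphic_map Xt Xt ?h"
    using hom by (rule homeomorphic_map_eq) simp
  then have "bij_betw ?h (topspace Xt) (topspace Xt)"
    by (metis bij_betw_def homeomorphic_imp_injective_map homeomorphic_imp_surjective_map)
  then have "?h \<in> carrier (deck_group Xt p)"
    using homh g by (simp add: deck_group_def Bij_def)
  moreover have "?h z = w"
    using g z by simp
  ultimately show thesis
    by (rule that)
qed

lemma deckD:
  assumes "h \<in> carrier (deck_group Xt p)"
  shows "homeomorphic_map Xt Xt h" and "u \<in> topspace Xt \<Longrightarrow> p (h u) = p u"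
    and "u \<in> topspace Xt \<Longrightarrow> h u \<in> topspace Xt"
  using assms homeomorphic_imp_surjective_map[of Xt Xt h] by (auto simp: deck_group_def)

lemma deck_free:
  assumes h: "h \<in> carrier (deck_group Xt p)" and z: "z \<in> topspace Xt" "h z = z"
    and u: "u \<in> topspace Xt"
  shows "h u = u"
  using self_lift(2)[OF z(1) z(1) refl _ z(2) deckD(2)[OF h] u]
    homeomorphic_imp_continuous_map[OF deckD(1)[OF h]] by blast

lemma orbit_deck_group:
  assumes z: "z \<in> topspace Xt"
  shows "orbit (deck_group Xt p) (\<lambda>h. h) z = {w \<in> topspace Xt. p w = p z}"
proof -
  have "w \<in> orbit (deck_group Xt p) (\<lambda>h. h) z" if "w \<in> topspace Xt" "p w = p z" for w
    using deck_transitive[OF z that] unfolding orbit_def by blast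
  moreover have "orbit (deck_group Xt p) (\<lambda>h. h) z \<subseteq> {w \<in> topspace Xt. p w = p z}"
    unfolding orbit_def using deckD(2,3)[OF _ z] by blast
  ultimately show ?thesis
    by blast
qed

text \<open>Orbits are fibres, and since \<open>p\<close> is onto they are indexed by the points of
  \<open>X\<close>.\<close>

lemma fundamental_domain_iff:
  "fundamental_domain (deck_group Xt p) (topspace Xt) (\<lambda>h. h) F \<longleftrightarrow>
     F \<subseteq> topspace Xt \<and> (\<forall>x\<in>topspace X. \<exists>!z. z \<in> F \<and> p z = x)"
proof -
  have "orbits (deck_group Xt p) (topspace Xt) (\<lambda>h. h) =
      (\<lambda>z. {w \<in> topspace Xt. p w = p z}) ` topspace Xt"
    unfolding orbits_def Setcompr_eq_image Collect_mem_eq by (intro image_cong refl orbit_deck_group)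
  also have "\<dots> = (\<lambda>x. {w \<in> topspace Xt. p w = x}) ` topspace X"
    unfolding p_onto[symmetric] by (simp add: image_image)
  finally show ?thesis
    unfolding fundamental_domain_def by (auto 4 4 simp: subset_iff)
qed

text \<open>If every neighbourhood of \<open>z'\<close> contained a point \<open>z \<noteq> z'\<close> of the same fibre, then jumping from \<open>z'\<close>
  to \<open>z\<close> right after time \<open>0\<close> would be a continuous lift of a constant path.\<close>

lemma t1_space_cover:
  assumes "t1_space X"
  shows "t1_space Xt"
  unfolding t1_space_def
proof (intro ballI impI)
  fix z' z assume z': "z' \<in> topspace Xt" and z: "z \<in> topspace Xt" and "z' \<noteq> z"
  show "\<exists>U. openin Xt U \<and> z' \<in> U \<and> z \<notin> U"
  proof (rule ccontr)
    assume "\<not> ?thesis"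
    then have U: "z \<in> U" if "openin Xt U" "z' \<in> U" for U
      using that by blast
    \<comment> \<open>Different projections could be separated in \<open>X\<close>, and the preimage
      would then separate \<open>z'\<close> from \<open>z\<close>.\<close>
    have "p z' = p z"
    proof (rule ccontr)
      assume "p z' \<noteq> p z"
      then obtain V where "openin X V" "p z' \<in> V" "p z \<notin> V"
        using assms z z' p_onto unfolding t1_space_def by blast
      then show False
        using U[of "{u \<in> topspace Xt. p u \<in> V}"] z'
          openin_continuous_map_preimage[OF p_continuous] by blast
    qed
    let ?c = "\<lambda>t::real. if t = 0 then z' else z"
    have "pathin Xt ?c"
      unfolding pathin_def continuous_map_def
    proof (intro conjI allI impI)
      show "?c \<in> topspace (top_of_set {0..1}) \<rightarrow> topspace Xt"
        using z z' by auto
      fix W assume W: "openin Xt W"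
      \<comment> \<open>The fourth combination, \<open>W\<close> containing \<open>z'\<close> but
        not \<open>z\<close>, is excluded by the assumption on \<open>z'\<close> and
        \<open>z\<close>.\<close>
      consider "z' \<in> W" "z \<in> W" | "z' \<notin> W" "z \<in> W" | "z' \<notin> W" "z \<notin> W"
        using U[OF W] by blast
      then show "openin (top_of_set {0..1}) {x \<in> topspace (top_of_set {0..1}). ?c x \<in> W}"
      proof cases
        case 1
        then have "{x \<in> topspace (top_of_set {0..1}). ?c x \<in> W} = topspace (top_of_set {0..1})"
          by auto
        then show ?thesis by (metis openin_topspace)
      next
        case 2
        then have "{x \<in> topspace (top_of_set {0..1}). ?c x \<in> W} = {0..1} \<inter> {0<..}"
          by auto
        then show ?thesis by (metis open_greaterThan openin_open_Int)
      next
        case 3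
        then have "{x \<in> topspace (top_of_set {0..1}). ?c x \<in> W} = {}"
          by auto
        then show ?thesis by (metis openin_empty)
      qed
    qed
    then have "?c 1 = z'"
      by (rule path_lift_unique[where d = "\<lambda>_. z'"]) (use z' \<open>p z' = p z\<close> in auto)
    then show False
      using \<open>z' \<noteq> z\<close> by simp
  qed
qed

section \<open>Open sets on which the projection is injective\<close>

text \<open>By transitivity on fibres the saturation is the union of the deck translates of
  \<open>V\<close>, each of them open. It is used to discard whole fibres at once.\<close>

lemma openin_saturation:
  assumes V: "openin Xt V"
  shows "openin Xt {z \<in> topspace Xt. p z \<in> p ` V}"
proof -
  have Vt: "V \<subseteq> topspace Xt"
    using V by (rule openin_subset)
  have "{z \<in> topspace Xt. p z \<in> p ` V} = (\<Union>h\<in>carrier (deck_group Xt p). h ` V)"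
  proof (intro equalityI subsetI)
    fix z assume z: "z \<in> {z \<in> topspace Xt. p z \<in> p ` V}"
    then obtain v where v: "v \<in> V" "p z = p v" by blast
    then obtain h where "h \<in> carrier (deck_group Xt p)" "h v = z"
      using z Vt deck_transitive[of v z] by blast
    with v show "z \<in> (\<Union>h\<in>carrier (deck_group Xt p). h ` V)"
      by blast
  next
    fix z assume "z \<in> (\<Union>h\<in>carrier (deck_group Xt p). h ` V)"
    then obtain h v where h: "h \<in> carrier (deck_group Xt p)" and v: "v \<in> V" "z = h v"
      by blast
    with Vt deckD(2,3)[OF h, of v] show "z \<in> {z \<in> topspace Xt. p z \<in> p ` V}"
      by auto
  qed
  moreover have "openin Xt (h ` V)" if "h \<in> carrier (deck_group Xt p)" for h
    using homeomorphic_map_openness[OF deckD(1)[OF that] Vt] V by simp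
  ultimately show ?thesis
    by auto
qed

section \<open>Path components over subsets of \<open>X\<close>\<close>

definition sheets :: "'a set \<Rightarrow> 'b set set" where
  "sheets U = {C \<in> path_components_of (subtopology Xt {z \<in> topspace Xt. p z \<in> U}). inj_on p C}"

text \<open>The image of \<open>C\<close> is path-connected, stays over \<open>U\<close> and meets
  \<open>C'\<close>, so maximality of path components applies.\<close>

lemma deck_image_path_component_subset:
  assumes C: "C \<in> path_components_of (subtopology Xt {z \<in> topspace Xt. p z \<in> U})"
    and C': "C' \<in> path_components_of (subtopology Xt {z \<in> topspace Xt. p z \<in> U})"
    and h: "h \<in> carrier (deck_group Xt p)" and z: "z \<in> C" "h z \<in> C'"
  shows "h ` C \<subseteq> C'"
proof -
  have "path_connectedin Xt C" and Cs: "C \<subseteq> {z \<in> topspace Xt. p z \<in> U}"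
    using path_connectedin_path_components_of[OF C] by (auto simp: path_connectedin_subtopology)
  then have "path_connectedin Xt (h ` C)"
    using path_connectedin_continuous_map_image homeomorphic_imp_continuous_map[OF deckD(1)[OF h]] by blast
  moreover have "h ` C \<subseteq> {z \<in> topspace Xt. p z \<in> U}"
    using Cs deckD[OF h] by auto
  ultimately have "path_connectedin (subtopology Xt {z \<in> topspace Xt. p z \<in> U}) (h ` C)"
    by (simp add: path_connectedin_subtopology)
  then show ?thesis
    by (rule path_components_of_maximal[OF C']) (use z in \<open>auto simp: disjnt_iff\<close>)
qed

text \<open>A deck transformation taking \<open>z\<close> to \<open>z'\<close> moves
  \<open>C\<close> into \<open>C'\<close> without changing projections.\<close>

lemma path_component_image_subset:
  assumes C: "C \<in> path_components_of (subtopology Xt {z \<in> topspace Xt. p z \<in> U})"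
    and C': "C' \<in> path_components_of (subtopology Xt {z \<in> topspace Xt. p z \<in> U})"
    and z: "z \<in> C" "z' \<in> C'" "p z = p z'"
  shows "p ` C \<subseteq> p ` C'"
proof -
  have sub: "C \<subseteq> topspace Xt" "C' \<subseteq> topspace Xt"
    using path_components_of_subset[OF C] path_components_of_subset[OF C'] by auto
  then obtain h where h: "h \<in> carrier (deck_group Xt p)" "h z = z'"
    using deck_transitive[of z z'] z by (metis subsetD)
  have "h ` C \<subseteq> C'"
    by (rule deck_image_path_component_subset[OF C C' h(1) z(1)]) (use h z in auto)
  then have "p ` h ` C \<subseteq> p ` C'"
    by blast
  moreover have "p ` h ` C = p ` C"
    unfolding image_image using deckD(2)[OF h(1)] sub by (intro image_cong) auto
  ultimately show ?thesis
    by simp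
qed

lemma injective_open_section:
  assumes U: "openin X U"
  obtains V where "openin Xt V" "inj_on p V" "p ` V = p ` \<Union>(sheets U)"
proof
  text \<open>Components in one orbit of the deck group are those with the same image under \<open>p\<close>.\<close>
  define rep where "rep D = (SOME C. C \<in> sheets U \<and> p ` C = D)" for D
  define V where "V = (\<Union>C\<in>sheets U. rep (p ` C))"
  have rep: "rep (p ` C) \<in> sheets U" "p ` rep (p ` C) = p ` C" if "C \<in> sheets U" for C
    using someI[of "\<lambda>C'. C' \<in> sheets U \<and> p ` C' = p ` C" C] that by (auto simp: rep_def)
  have oU: "openin Xt {z \<in> topspace Xt. p z \<in> U}"
    using U by (rule openin_continuous_map_preimage[OF p_continuous])
  \<comment> \<open>Path components of an open subset of a locally path-connected space are
    open.\<close>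
  have "openin Xt C" if "C \<in> sheets U" for C
    using openin_path_components_of_locally_path_connected_space
      locally_path_connected_space_open_subset[OF locally_path_connected oU] that
      openin_open_subtopology[OF oU] unfolding sheets_def by blast
  then show "openin Xt V"
    unfolding V_def using rep by (intro openin_Union) auto
  show "inj_on p V"
  proof (rule inj_onI)
    fix z z' assume "z \<in> V" "z' \<in> V" and eq: "p z = p z'"
    then obtain C C' where C: "C \<in> sheets U" "z \<in> rep (p ` C)"
      and C': "C' \<in> sheets U" "z' \<in> rep (p ` C')"
      by (auto simp: V_def)
    have comps: "rep (p ` C) \<in> path_components_of (subtopology Xt {z \<in> topspace Xt. p z \<in> U})"
      "rep (p ` C') \<in> path_components_of (subtopology Xt {z \<in> topspace Xt. p z \<in> U})"
      using rep(1)[OF C(1)] rep(1)[OF C'(1)] by (auto simp: sheets_def)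
    \<comment> \<open>Components over \<open>U\<close> whose images share a point have equal images.
      So \<open>z\<close> and \<open>z'\<close> lie in the same representative, on which
      \<open>p\<close> is injective.\<close>
    have "p ` rep (p ` C) = p ` rep (p ` C')"
      using path_component_image_subset[OF comps C(2) C'(2) eq]
        path_component_image_subset[OF comps(2,1) C'(2) C(2) eq[symmetric]] by (rule equalityI)
    then have "p ` C = p ` C'"
      using rep C C' by simp
    then show "z = z'"
      using rep(1)[OF C(1)] C(2) C'(2) eq by (auto simp: sheets_def inj_on_def)
  qed
  show "p ` V = p ` \<Union>(sheets U)"
    unfolding V_def image_UN image_Union using rep by simp
qed

text \<open>A deck transformation that maps a point of \<open>C\<close> into \<open>C\<close> moves a point \<open>w\<close> over \<open>x\<close> along a path
  inside \<open>C\<close>, whose projection is a loop in \<open>U\<close> and hence null-homotopic in \<open>X\<close>; so it fixes \<open>w\<close>.\<close>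

lemma semilocally_simply_connected_sheet:
  assumes "semilocally_simply_connected_at X x"
  obtains U where "openin X U" "x \<in> U" "\<And>B. B \<subseteq> U \<Longrightarrow> x \<in> B \<Longrightarrow> x \<in> p ` \<Union>(sheets B)"
proof -
  obtain U V where U: "openin X U" "x \<in> U" "U \<subseteq> V" "V \<subseteq> topspace X"
    and triv: "trivial_on_fundamental_group (subtopology X V) X (\<lambda>v. v) x"
    using assms by (auto simp: semilocally_simply_connected_at_def)
  have null: "path_homotopic X (\<lambda>_. x) g" if "g \<in> loops_at X x" "g ` {0..1} \<subseteq> V" for g
  proof -
    have "continuous_map (subtopology X V) X (\<lambda>v. v)"
      using continuous_map_from_subtopology[OF continuous_map_id] by (simp add: id_def)
    moreover have "x \<in> topspace (subtopology X V)"
      using U by auto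
    ultimately show ?thesis
      using triv that by (auto simp: trivial_on_fundamental_group_iff loops_at_def pathin_subtopology o_def)
  qed
  \<comment> \<open>Loops in a smaller \<open>B\<close> still lie in \<open>V\<close>. Allowing
    every such \<open>B\<close> later lets \<open>B\<close> be a member of a countable base.\<close>
  have "x \<in> p ` \<Union>(sheets B)" if B: "B \<subseteq> U" "x \<in> B" for B
  proof -
    let ?T = "subtopology Xt {z \<in> topspace Xt. p z \<in> B}"
    have "x \<in> p ` topspace Xt"
      unfolding p_onto using U by blast
    then obtain w where w: "w \<in> topspace Xt" "p w = x"
      by blast
    define C where "C = Collect (path_component_of ?T w)"
    have wT: "w \<in> topspace ?T"
      using w B by simp
    have C: "C \<in> path_components_of ?T"
      using wT by (auto simp: C_def path_components_of_def)
    have wC: "w \<in> C"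
      using wT by (simp add: C_def path_component_of_refl)
    have "inj_on p C"
    proof (rule inj_onI)
      fix z z' assume z: "z \<in> C" "z' \<in> C" and eq: "p z = p z'"
      have zt: "z \<in> topspace Xt" "z' \<in> topspace Xt"
        using z path_components_of_subset[OF C] by auto
      obtain h where h: "h \<in> carrier (deck_group Xt p)" "h z = z'"
        using deck_transitive[OF zt eq[symmetric]] by blast
      have "h w \<in> C"
        using deck_image_path_component_subset[OF C C h(1) z(1)] h(2) z(2) wC by blast
      then obtain c where c: "pathin ?T c" "c 0 = w" "c 1 = h w"
        by (auto simp: C_def path_component_of_set)
      then have cX: "pathin Xt c" and cB: "\<And>t. t \<in> {0..1} \<Longrightarrow> p (c t) \<in> B"
        by (auto simp: pathin_subtopology)
      have "h w = w"
      proof -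
        have "p \<circ> c \<in> loops_at X x"
          using pathin_compose[OF cX p_continuous] c w deckD(2)[OF h(1)] by (simp add: loops_at_def)
        then have "path_homotopic X (\<lambda>_. x) (p \<circ> c)"
        proof (rule null)
          show "(p \<circ> c) ` {0..1} \<subseteq> V"
            using cB B(1) U(3) by fastforce
        qed
        then show ?thesis
          using lift_of_null_homotopic_loop_closed[OF cX] c w by simp
      qed
      then show "z = z'"
        using deck_free[OF h(1) w(1) _ zt(1)] h(2) by simp
    qed
    then have "C \<in> sheets B"
      using C by (simp add: sheets_def)
    then show ?thesis
      using wC w by blast
  qed
  with U that show thesis
    by blast
qed

section \<open>The fundamental domain\<close>

text \<open>Each fibre that meets some \<open>V n\<close> gets its point from the first such
  \<open>V n\<close>; for the countably many others a point is chosen by \<open>s\<close>.\<close>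

lemma borel_cross_section:
  fixes V :: "nat \<Rightarrow> 'b set"
  assumes "t1_space X"
    and V: "\<And>n. openin Xt (V n)" "\<And>n. inj_on p (V n)"
    and rest: "countable (topspace X - (\<Union>n. p ` V n))"
  shows "\<exists>F. F \<in> borel_sets_of Xt \<and> F \<subseteq> topspace Xt \<and> (\<forall>x\<in>topspace X. \<exists>!z. z \<in> F \<and> p z = x)"
proof -
  define R where "R = topspace X - (\<Union>n. p ` V n)"
  define s where "s x = (SOME z. z \<in> topspace Xt \<and> p z = x)" for x
  have s: "s x \<in> topspace Xt" "p (s x) = x" if "x \<in> topspace X" for x
  proof -
    have "x \<in> p ` topspace Xt"
      using that by (simp add: p_onto)
    then have "\<exists>z. z \<in> topspace Xt \<and> p z = x"
      by blast
    from someI_ex[OF this] show "s x \<in> topspace Xt" "p (s x) = x"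
      by (auto simp: s_def)
  qed
  \<comment> \<open>Subtracting the saturations, and not just the sets \<open>V m\<close>, removes
    every fibre already served.\<close>
  define W where "W n = V n - (\<Union>m<n. {z \<in> topspace Xt. p z \<in> p ` V m})" for n
  define F where "F = (\<Union>n. W n) \<union> s ` R"
  interpret sigma_algebra "topspace Xt" "borel_sets_of Xt"
    unfolding borel_sets_of_def by (rule sigma_algebra_sigma_sets) (auto dest: openin_subset)
  have borel_open: "openin Xt A \<Longrightarrow> A \<in> borel_sets_of Xt" for A
    unfolding borel_sets_of_def by (rule sigma_sets.Basic) simp
  have borel_point: "{z} \<in> borel_sets_of Xt" if "z \<in> topspace Xt" for z
  proof -
    have "closedin Xt {z}"
      using t1_space_cover[OF \<open>t1_space X\<close>] that by (simp add: t1_space_closedin_singleton)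
    then have "topspace Xt - (topspace Xt - {z}) \<in> borel_sets_of Xt"
      by (intro compl_sets borel_open) auto
    then show ?thesis
      using that by (simp add: double_diff)
  qed
  have "W n \<in> borel_sets_of Xt" for n
    unfolding W_def using V(1) openin_saturation
    by (intro Diff borel_open openin_Union) auto
  moreover have "s ` R \<in> borel_sets_of Xt"
  proof -
    have "(\<Union>x\<in>R. {s x}) \<in> borel_sets_of Xt"
      using rest s by (intro countable_UN') (auto simp: R_def intro: borel_point)
    then show ?thesis
      by (simp add: UNION_singleton_eq_range)
  qed
  ultimately have F: "F \<in> borel_sets_of Xt"
    unfolding F_def by (intro Un countable_UN) auto
  have "\<exists>!z. z \<in> F \<and> p z = x" if x: "x \<in> topspace X" for x
  proof (cases "x \<in> R")
    case True
    \<comment> \<open>Over \<open>R\<close> no \<open>V n\<close> has a point, so \<open>s x\<close>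
      is the only candidate.\<close>
    then have "z \<notin> W n" if "p z = x" for z n
      using that by (auto simp: R_def W_def)
    then show ?thesis
      using True s[OF x] s by (intro ex1I[of _ "s x"]) (auto simp: F_def R_def)
  next
    case False
    then have ex: "\<exists>n. x \<in> p ` V n"
      using x by (auto simp: R_def)
    define n where "n = (LEAST n. x \<in> p ` V n)"
    have n: "x \<in> p ` V n" "\<And>m. m < n \<Longrightarrow> x \<notin> p ` V m"
      unfolding n_def using LeastI_ex[OF ex] not_less_Least by blast+
    obtain z where z: "z \<in> V n" "p z = x"
      using n(1) by blast
    then have "z \<in> W n"
      using n(2) by (auto simp: W_def)
    moreover have "z' = z" if z': "z' \<in> F" "p z' = x" for z'
    proof -
      have "z' \<notin> s ` R"
      proof
        assume "z' \<in> s ` R"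
        then obtain r where r: "r \<in> R" "z' = s r"
          by blast
        then have "r = x"
          using s(2)[of r] z'(2) by (simp add: R_def)
        with r False show False
          by simp
      qed
      then obtain m where m: "z' \<in> W m"
        using z'(1) by (auto simp: F_def)
      \<comment> \<open>If \<open>n < m\<close>, then \<open>z'\<close> would lie in the saturation
        of \<open>V n\<close>, which was removed from \<open>W m\<close>; \<open>m < n\<close> would
        contradict the minimality of \<open>n\<close>.\<close>
      then have "z' \<in> V m" "\<not> n < m"
        using z' n(1) V(1)[of m] by (auto simp: W_def dest: openin_subset)
      moreover have "\<not> m < n"
        using n(2)[of m] \<open>z' \<in> V m\<close> z'(2) by blast
      ultimately have "z' \<in> V n"
        by (metis linorder_neqE_nat)
      then show ?thesis
        using V(2)[of n] z z'(2) by (auto dest: inj_onD)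
    qed
    ultimately show ?thesis
      using z(2) by (intro ex1I[of _ z]) (auto simp: F_def)
  qed
  then show ?thesis
    using F sets_into_space[OF F] by (intro exI[of _ F] conjI ballI)
qed

end

theorem lemma2p3:
  fixes X :: "'a topology" and Xt :: "'b topology" and p :: "'b \<Rightarrow> 'a"
  assumes "second_countable X" and "t1_space X"
    and "countable {x \<in> topspace X. \<not> semilocally_simply_connected_at X x}"
    and "generalized_universal_covering Xt X p"
  shows "\<exists>F. F \<in> borel_sets_of Xt \<and>
             fundamental_domain (deck_group Xt p) (topspace Xt) (\<lambda>h. h) F"
proof -
  interpret generalized_universal_cover Xt X p
    using assms(4) by unfold_locales
  obtain \<B> where \<B>: "countable \<B>" "\<And>B. B \<in> \<B> \<Longrightarrow> openin X B"
    "\<And>U x. openin X U \<Longrightarrow> x \<in> U \<Longrightarrow> \<exists>B\<in>\<B>. x \<in> B \<and> B \<subseteq> U"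
    using assms(1) unfolding second_countable_def by metis
  \<comment> \<open>Inserting the empty set makes the enumerated set nonempty, as
    \<open>from_nat_into\<close> needs to have exactly it as range.\<close>
  define b where "b = from_nat_into (insert {} \<B>)"
  have b: "range b = insert {} \<B>"
    unfolding b_def using \<B>(1) by (intro range_from_nat_into) auto
  have "openin X (b n)" for n
    using b \<B>(2) by (metis insertE openin_empty rangeI)
  then have "\<exists>V. openin Xt V \<and> inj_on p V \<and> p ` V = p ` \<Union>(sheets (b n))" for n
    using injective_open_section by metis
  then obtain V where V: "\<And>n. openin Xt (V n)" "\<And>n. inj_on p (V n)"
    "\<And>n. p ` V n = p ` \<Union>(sheets (b n))"
    by metis
  have "x \<in> (\<Union>n. p ` V n)" if sl: "semilocally_simply_connected_at X x" for x
  proof -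
    obtain U where U: "openin X U" "x \<in> U" "\<And>B. B \<subseteq> U \<Longrightarrow> x \<in> B \<Longrightarrow> x \<in> p ` \<Union>(sheets B)"
      using semilocally_simply_connected_sheet[OF sl] by metis
    then obtain B where B: "B \<in> \<B>" "x \<in> B" "B \<subseteq> U"
      using \<B>(3)[OF U(1,2)] by blast
    then have "B \<in> range b"
      by (simp add: b)
    then obtain n where "B = b n"
      by blast
    then have "x \<in> p ` V n"
      using U(3)[OF B(3,2)] V(3) by simp
    then show ?thesis
      by blast
  qed
  then have "topspace X - (\<Union>n. p ` V n) \<subseteq> {x \<in> topspace X. \<not> semilocally_simply_connected_at X x}"
    by blast
  then have "countable (topspace X - (\<Union>n. p ` V n))"
    using assms(3) countable_subset by blast
  from borel_cross_section[OF assms(2) V(1,2) this] show ?thesis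
    by (simp add: fundamental_domain_iff)
qed

end
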